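(* Let $X\subset\mathbb{R}^2$ be a smooth closed curve and let $P_1,P_2,P_3$ be three distinct points on $X$. Then there exist charges $[q_1:q_2:q_3]$ such that $P_1,P_2,P_3$ are in $E_q$-equilibrium if and only if $P_1,P_2,P_3$ form an orthotripod on $X$.
   Context: Write $p_i=\overrightarrow{OP_i}$ for the position vector of $P_i$, $d_{ij}=\|p_i-p_j\|$, and let $T_i$ be the (unit) tangent vector to $X$ at $P_i$. The Coulomb potential of charges $q=(q_1,q_2,q_3)$ at $P_1,P_2,P_3$ is $E_q=-\sum_{i<j}\frac{q_iq_j}{d_{ij}}$, and the force between the points is $F_{ji}=\frac{q_iq_j}{d_{ij}^3}(p_i-p_j)$. Equilibrium means that at every $P_i$ the resultant force is orthogonal to $T_i$; for three points this is expressed by a linear system as follows. Put $a_{ij}=\frac{\langle p_i-p_j,T_i\rangle}{d_{ij}^3}$ for $i\ne j$ and $a_{ii}=0$. The points $P_1,P_2,P_3$ are in $E_q$-equilibrium for the charges $q=(q_1,q_2,q_3)\neq(0,0,0)$ (real numbers, considered up to a common nonzero factor) if $\sum_{j\neq i}a_{ij}q_j=0$ for $i=1,2,3$, i.e. $(a_{ij})\,q=0$. An orthotripod on a smooth closed curve $X$ is an unordered triple of distinct points of $X$ such that the three normal lines to $X$ at these points are concurrent, that is, have a common point.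
   Formalization: The equivalence is proved when the three points are not collinear and their tangents are not all parallel, since otherwise charges always exist though the normals may not be concurrent; "orthotripod implies equilibrium charges exist" is proved with no extra condition. *)

theory Defs
  imports "HOL-Analysis.Analysis"
begin

text \<open>The sequence \<open>D\<close> lists the derivatives of all orders of \<open>g\<close>, so \<open>g\<close> is
  \<open>C\<^sup>\<infinity>\<close> on the whole line.\<close>

definition smooth :: "(real \<Rightarrow> real^2) \<Rightarrow> bool" where
  "smooth g \<longleftrightarrow> (\<exists>D :: nat \<Rightarrow> real \<Rightarrow> real^2. D 0 = g \<and>
     (\<forall>n t. (D n has_vector_derivative D (Suc n) t) (at t)))"

text \<open>Normalising the period to 1 is no restriction. Injectivity on a period makes the curve
  simple, so that it has a well-defined tangent line at each of its points.\<close>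

definition parametrizes :: "(real \<Rightarrow> real^2) \<Rightarrow> (real^2) set \<Rightarrow> bool" where
  "parametrizes g X \<longleftrightarrow>
     smooth g \<and> (\<forall>t. g (t + 1) = g t) \<and> inj_on g {0..<1} \<and>
     (\<forall>t. vector_derivative g (at t) \<noteq> 0) \<and> X = range g"

definition smooth_closed_curve :: "(real^2) set \<Rightarrow> bool" where
  "smooth_closed_curve X \<longleftrightarrow> (\<exists>g. parametrizes g X)"

text \<open>The unit tangent vector is determined only up to sign, whence a relation. Both signs
  occur, because \<open>\<lambda>t. g (- t)\<close> parametrizes \<open>X\<close> whenever \<open>g\<close> does.\<close>

definition unit_tangent :: "(real^2) set \<Rightarrow> real^2 \<Rightarrow> real^2 \<Rightarrow> bool" where
  "unit_tangent X p v \<longleftrightarrow>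
     (\<exists>g t. parametrizes g X \<and> g t = p \<and> v = sgn (vector_derivative g (at t)))"

definition normal_line :: "(real^2) set \<Rightarrow> real^2 \<Rightarrow> (real^2) set" where
  "normal_line X p = {c. \<exists>v. unit_tangent X p v \<and> (c - p) \<bullet> v = 0}"

definition orthotripod :: "(real^2) set \<Rightarrow> (real^2) set \<Rightarrow> bool" where
  "orthotripod X S \<longleftrightarrow> S \<subseteq> X \<and> card S = 3 \<and> (\<Inter>p\<in>S. normal_line X p) \<noteq> {}"

definition coulomb_matrix :: "(3 \<Rightarrow> real^2) \<Rightarrow> (3 \<Rightarrow> real^2) \<Rightarrow> real^3^3" where
  "coulomb_matrix P T =
     (\<chi> i j. if i = j then 0 else ((P i - P j) \<bullet> T i) / dist (P i) (P j) ^ 3)"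

text \<open>Here \<open>T i\<close> is the unit tangent vector chosen at \<open>P i\<close>. The predicate is invariant under
  scaling \<open>q\<close> by a nonzero factor, so it is a condition on the point of the projective plane
  with homogeneous coordinates \<open>q\<close>; it is also invariant under changing the sign of any \<open>T i\<close>.\<close>

definition in_equilibrium :: "(3 \<Rightarrow> real^2) \<Rightarrow> (3 \<Rightarrow> real^2) \<Rightarrow> real^3 \<Rightarrow> bool" where
  "in_equilibrium P T q \<longleftrightarrow> q \<noteq> 0 \<and> coulomb_matrix P T *v q = 0"

end

(* Up to the positive factor (d12 d23 d31)^3, the determinant of the Coulomb matrix is twice the
   signed area of the triangle times the determinant of the 3x3 matrix with rows
   (T_i, -<p_i, T_i>). A kernel vector (x, y, z) of the latter with nonzero z is a common point
   (x/z, y/z) of the three normals; z = 0 would force all tangents to be parallel. *)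

theory Submission
  imports Defs
begin

section \<open>Parallelism in the plane via the cross product\<close>

definition cross2 :: "real^2 \<Rightarrow> real^2 \<Rightarrow> real" where
  "cross2 a b = a$1 * b$2 - a$2 * b$1"

lemma cross2_scaleR: "cross2 (r *\<^sub>R a) (s *\<^sub>R b) = r * s * cross2 a b"
  by (simp add: cross2_def algebra_simps)

lemma cross2_self [simp]: "cross2 a a = 0"
  by (simp add: cross2_def)

lemma tendsto_cross2:
  assumes "(f \<longlongrightarrow> a) F" "(g \<longlongrightarrow> b) F"
  shows "((\<lambda>x. cross2 (f x) (g x)) \<longlongrightarrow> cross2 a b) F"
  unfolding cross2_def by (intro tendsto_intros assms)

lemma inner_real2: "(a::real^2) \<bullet> b = a$1 * b$1 + a$2 * b$2"
  by (simp add: inner_vec_def sum_2)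

lemma cross2_eq_0_imp_scaleR:
  assumes "cross2 a b = 0" "a \<noteq> 0"
  obtains c where "b = c *\<^sub>R a"
proof (cases "a$1 = 0")
  case True
  with assms(2) have "a$2 \<noteq> 0" by (simp add: vec_eq_iff forall_2)
  with True assms(1) have "b = (b$2 / a$2) *\<^sub>R a"
    by (simp add: vec_eq_iff forall_2 cross2_def)
  then show ?thesis using that by blast
next
  case False
  with assms(1) have "b = (b$1 / a$1) *\<^sub>R a"
    by (simp add: vec_eq_iff forall_2 cross2_def field_simps)
  then show ?thesis using that by blast
qed

lemma cross2_eq_0_imp_sgn:
  assumes "cross2 a b = 0" "a \<noteq> 0" "b \<noteq> 0"
  shows "sgn b = sgn a \<or> sgn b = - sgn a"
proof -
  obtain c where c: "b = c *\<^sub>R a"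
    using cross2_eq_0_imp_scaleR assms(1,2) by blast
  with assms(3) have "c \<noteq> 0" by auto
  then show ?thesis
    unfolding c sgn_scaleR by (auto simp: sgn_real_def)
qed

lemma cross2_eq_0_imp_orthogonal_to_common:
  assumes "x \<bullet> a = 0" "x \<bullet> b = 0" "x \<noteq> 0"
  shows "cross2 a b = 0"
proof -
  \<comment> \<open>Up to sign, both products are combinations of \<open>x \<bullet> a\<close> and
    \<open>x \<bullet> b\<close>; for example \<open>x$1 * cross2 a b = (x \<bullet> a) * b$2 - (x
    \<bullet> b) * a$2\<close>.\<close>
  have "x$1 * cross2 a b = 0" "x$2 * cross2 a b = 0"
    using assms(1,2) unfolding inner_real2 cross2_def by algebra+
  with assms(3) show ?thesis
    by (auto simp: vec_eq_iff forall_2)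
qed

lemma not_collinear_imp_cross2:
  assumes "\<not> collinear {a, b, c}"
  shows "cross2 (a - b) (c - b) \<noteq> 0"
proof
  assume "cross2 (a - b) (c - b) = 0"
  then have "collinear {0, a - b, c - b}"
    using cross2_eq_0_imp_scaleR[of "a - b" "c - b"] by (auto simp: collinear_lemma)
  with assms show False by (simp add: collinear_3[of a b c])
qed

subsection \<open>The tangent direction does not depend on the parametrization\<close>

lemma parametrizes_periodic:
  assumes "parametrizes g X"
  shows "g (t + of_int k) = g t"
proof -
  have nat: "g (t + real n) = g t" for n t
  proof (induction n)
    case (Suc n)
    have "g (t + real (Suc n)) = g ((t + real n) + 1)" by (simp add: algebra_simps)
    also have "\<dots> = g (t + real n)" using assms unfolding parametrizes_def by blast
    finally show ?case using Suc by simp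
  qed simp
  show ?thesis
  proof (cases "k \<ge> 0")
    case True
    then show ?thesis using nat[of t "nat k"] by simp
  next
    case False
    then show ?thesis using nat[of "t + of_int k" "nat (- k)"] by simp
  qed
qed

lemma parametrizes_eq_imp:
  assumes "parametrizes g X" "g s = g t"
  shows "s - t \<in> \<int>"
proof -
  have "g (frac x) = g x" for x
    using parametrizes_periodic[OF assms(1), of x "- \<lfloor>x\<rfloor>"] by (simp add: frac_def)
  with assms have "g (frac s) = g (frac t)" by simp
  moreover have "inj_on g {0..<1}" using assms(1) by (simp add: parametrizes_def)
  ultimately have "frac s = frac t"
    by (auto dest!: inj_onD simp: frac_lt_1)
  then have "s - t = of_int (\<lfloor>s\<rfloor> - \<lfloor>t\<rfloor>)" by (simp add: frac_def)
  then show ?thesis by (metis Ints_of_int)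
qed

text \<open>Subtracting the nearest integer to \<open>r - t\<close> moves any parameter
  \<open>r\<close> of \<open>p\<close> into the window. The window is closed so that it is compact,
  and \<open>t\<close> is the only parameter in it congruent to \<open>t\<close> modulo 1.\<close>

lemma parametrizes_near:
  assumes "parametrizes g X" "p \<in> X"
  obtains s where "s \<in> {t - 1/2..t + 1/2}" "g s = p"
proof -
  obtain r where r: "g r = p" using assms by (auto simp: parametrizes_def)
  have "g (r + of_int (- round (r - t))) = p"
    using r parametrizes_periodic[OF assms(1)] by metis
  moreover have "\<bar>of_int (round (r - t)) - (r - t)\<bar> \<le> 1/2"
    by (rule of_int_round_abs_le)
  then have "r + of_int (- round (r - t)) \<in> {t - 1/2..t + 1/2}"
    unfolding atLeastAtMost_iff by (simp only: abs_le_iff of_int_minus) linarith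
  ultimately show ?thesis using that by blast
qed

lemma parametrizes_derivative:
  assumes "parametrizes g X"
  shows "(g has_vector_derivative vector_derivative g (at t)) (at t)"
proof -
  have "\<exists>D. (g has_vector_derivative D) (at t)"
    using assms unfolding parametrizes_def smooth_def by metis
  then show ?thesis by (metis vector_derivative_at)
qed

text \<open>The sequential form allows two parametrizations to be compared along one sequence of
  points of the curve.\<close>

lemma difference_quotient_tendsto:
  fixes g :: "real \<Rightarrow> 'a::real_normed_vector"
  assumes "(g has_vector_derivative D) (at t)"
    and "u \<longlonglongrightarrow> t" "\<And>n. u n \<noteq> t"
  shows "(\<lambda>n::nat. (1 / (u n - t)) *\<^sub>R (g (u n) - g t)) \<longlonglongrightarrow> D"
proof -
  have "((\<lambda>x. norm ((1 / norm (x - t)) *\<^sub>R (g x - (g t + (x - t) *\<^sub>R D)))) \<longlongrightarrow> 0) (at t)"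
    using assms(1) unfolding has_vector_derivative_def has_derivative_within
    by (intro tendsto_norm_zero) blast
  \<comment> \<open>Under the outer norm, the factor \<open>1 / norm (x - t)\<close> may be replaced
    by the signed \<open>1 / (x - t)\<close>.\<close>
  moreover have "norm ((1 / norm (x - t)) *\<^sub>R (g x - (g t + (x - t) *\<^sub>R D)))
      = norm ((1 / (x - t)) *\<^sub>R (g x - g t) - D)" if "x \<noteq> t" for x
  proof -
    have "(1 / (x - t)) *\<^sub>R (g x - g t) - D = (1 / (x - t)) *\<^sub>R (g x - (g t + (x - t) *\<^sub>R D))"
      using that by (simp add: scaleR_diff_right scaleR_add_right)
    then show ?thesis by simp
  qed
  ultimately have "((\<lambda>x. norm ((1 / (x - t)) *\<^sub>R (g x - g t) - D)) \<longlongrightarrow> 0) (at t)"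
    by (elim Lim_transform_eventually) (simp add: eventually_at_filter)
  then have "((\<lambda>x. (1 / (x - t)) *\<^sub>R (g x - g t)) \<longlongrightarrow> D) (at t)"
    by (simp only: tendsto_norm_zero_iff LIM_zero_iff)
  moreover have "filterlim u (at t) sequentially"
    using assms(2,3) by (simp add: filterlim_at)
  ultimately show ?thesis by (rule filterlim_compose)
qed

text \<open>Points of \<open>X\<close> tending to the common point give difference quotients of both
  parametrizations along the same secants, hence parallel to each other.\<close>

lemma parametrizes_derivatives_parallel:
  assumes g: "parametrizes g X" and h: "parametrizes h X" and eq: "g t = h s"
  shows "cross2 (vector_derivative g (at t)) (vector_derivative h (at s)) = 0"
proof -
  \<comment> \<open>The shift \<open>n + 2\<close> keeps the offset from \<open>s\<close> strictly
    between 0 and 1; an offset of 1 would be a full period and return to \<open>h s\<close>.\<close>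
  define u where "u n = s + 1 / real (n + 2)" for n
  have u: "u n \<noteq> s" "h (u n) \<noteq> h s" for n
  proof -
    show "u n \<noteq> s" by (simp add: u_def)
    show "h (u n) \<noteq> h s"
    proof
      assume "h (u n) = h s"
      then have "1 / real (n + 2) \<in> \<int>" using parametrizes_eq_imp[OF h] by (force simp: u_def)
      then obtain k :: int where k: "1 / real (n + 2) = of_int k" by (auto elim: Ints_cases)
      have "0 < 1 / real (n + 2)" "1 / real (n + 2) < 1" by simp_all
      then show False unfolding k by simp
    qed
  qed
  have u_lim: "u \<longlonglongrightarrow> s"
  proof -
    have "(\<lambda>n. s + inverse (real (Suc (Suc n)))) \<longlonglongrightarrow> s + 0"
      by (intro tendsto_intros LIMSEQ_Suc[OF LIMSEQ_inverse_real_of_nat])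
    then show ?thesis by (simp add: u_def[abs_def] inverse_eq_divide add.commute)
  qed
  have "\<exists>r. r \<in> {t - 1/2..t + 1/2} \<and> g r = h (u n)" for n
  proof -
    have "h (u n) \<in> X" using h by (auto simp: parametrizes_def)
    then show ?thesis using parametrizes_near[OF g] by metis
  qed
  then obtain v where v: "\<And>n. v n \<in> {t - 1/2..t + 1/2}" "\<And>n. g (v n) = h (u n)"
    by metis
  \<comment> \<open>The parameters \<open>v n\<close> need not converge, so compactness of the
    window supplies a subsequence. Continuity then gives \<open>g l = g t\<close>, and the width of
    the window forces \<open>l = t\<close>.\<close>
  obtain l r where l: "l \<in> {t - 1/2..t + 1/2}" and r: "strict_mono r" and lim: "(v \<circ> r) \<longlonglongrightarrow> l"
    using compact_Icc[of "t - 1/2" "t + 1/2"] v(1) unfolding compact_def by blast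
  have ur_lim: "(u \<circ> r) \<longlonglongrightarrow> s" by (rule LIMSEQ_subseq_LIMSEQ[OF u_lim r])
  have cont: "isCont g x" "isCont h x" for x
    using parametrizes_derivative[OF g] parametrizes_derivative[OF h]
      has_vector_derivative_continuous by blast+
  have "(\<lambda>n. g ((v \<circ> r) n)) \<longlonglongrightarrow> g l" by (rule isCont_tendsto_compose[OF cont(1) lim])
  moreover have "(\<lambda>n. h ((u \<circ> r) n)) \<longlonglongrightarrow> h s" by (rule isCont_tendsto_compose[OF cont(2) ur_lim])
  ultimately have "g l = g t" using LIMSEQ_unique by (force simp: v(2) eq)
  then have "l - t \<in> \<int>" by (rule parametrizes_eq_imp[OF g])
  then obtain k :: int where k: "l - t = of_int k" by (auto elim: Ints_cases)
  have "\<bar>of_int k :: real\<bar> \<le> 1/2" using l unfolding k[symmetric] abs_le_iff atLeastAtMost_iff by linarith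
  then have "k = 0" by linarith
  with k lim have lim: "(v \<circ> r) \<longlonglongrightarrow> t" by simp
  have ne: "(v \<circ> r) n \<noteq> t" "(u \<circ> r) n \<noteq> s" for n
    using v(2)[of "r n"] u[of "r n"] eq by (auto simp: o_def)
  \<comment> \<open>Both quotients are multiples of the same secant vector, because
    \<open>g (v n) = h (u n)\<close> and \<open>g t = h s\<close>.\<close>
  have "cross2 ((1 / ((v \<circ> r) n - t)) *\<^sub>R (g ((v \<circ> r) n) - g t))
      ((1 / ((u \<circ> r) n - s)) *\<^sub>R (h ((u \<circ> r) n) - h s)) = 0" for n
    by (simp add: cross2_scaleR v(2) eq)
  moreover have "(\<lambda>n. cross2 ((1 / ((v \<circ> r) n - t)) *\<^sub>R (g ((v \<circ> r) n) - g t))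
      ((1 / ((u \<circ> r) n - s)) *\<^sub>R (h ((u \<circ> r) n) - h s)))
    \<longlonglongrightarrow> cross2 (vector_derivative g (at t)) (vector_derivative h (at s))"
    by (intro tendsto_cross2 difference_quotient_tendsto parametrizes_derivative[OF g]
        parametrizes_derivative[OF h] lim ur_lim ne)
  ultimately show ?thesis by (simp add: LIMSEQ_const_iff)
qed

lemma unit_tangent_unique:
  assumes "unit_tangent X p v" "unit_tangent X p w"
  shows "w = v \<or> w = - v"
proof -
  obtain g t h s where *: "parametrizes g X" "g t = p" "v = sgn (vector_derivative g (at t))"
    "parametrizes h X" "h s = p" "w = sgn (vector_derivative h (at s))"
    using assms unfolding unit_tangent_def by blast
  then have "cross2 (vector_derivative g (at t)) (vector_derivative h (at s)) = 0"
    by (intro parametrizes_derivatives_parallel) auto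
  with * show ?thesis
    using cross2_eq_0_imp_sgn unfolding parametrizes_def by metis
qed

lemma norm_unit_tangent: "unit_tangent X p v \<Longrightarrow> norm v = 1"
  unfolding unit_tangent_def parametrizes_def by (auto simp: norm_sgn)

text \<open>Orthogonality to a vector ignores its sign, the only ambiguity left in the unit
  tangent.\<close>

lemma normal_line_eq:
  assumes "unit_tangent X p v"
  shows "normal_line X p = {c. (c - p) \<bullet> v = 0}"
  unfolding normal_line_def using unit_tangent_unique[OF assms] assms by fastforce

subsection \<open>Concurrency of the normals as a determinant\<close>

text \<open>Row \<open>i\<close> holds the homogeneous coordinates of the line through
  \<open>P i\<close> orthogonal to \<open>T i\<close>.\<close>

definition normal_matrix :: "(3 \<Rightarrow> real^2) \<Rightarrow> (3 \<Rightarrow> real^2) \<Rightarrow> real^3^3" where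
  "normal_matrix P T = (\<chi> i. vector [T i $ 1, T i $ 2, - (P i \<bullet> T i)])"

lemma normal_matrix_mult:
  "(normal_matrix P T *v x) $ i = x$1 * T i $ 1 + x$2 * T i $ 2 - x$3 * (P i \<bullet> T i)"
  by (simp add: normal_matrix_def matrix_vector_mult_def sum_3 algebra_simps)

lemma det_eq_0_iff_kernel:
  fixes A :: "real^'n^'n"
  shows "det A = 0 \<longleftrightarrow> (\<exists>x. x \<noteq> 0 \<and> A *v x = 0)"
  using invertible_det_nz[of A] invertible_left_inverse[of A] matrix_left_invertible_ker[of A] by blast

lemma det_normal_matrix_eq_0:
  assumes "\<And>i. (c - P i) \<bullet> T i = 0"
  shows "det (normal_matrix P T) = 0"
proof -
  have "normal_matrix P T *v vector [c$1, c$2, 1] = 0"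
    using assms by (simp add: vec_eq_iff normal_matrix_mult inner_real2 algebra_simps)
  moreover have "(vector [c$1, c$2, 1] :: real^3) \<noteq> 0"
    by (metis vector_3(3) zero_index zero_neq_one)
  ultimately show ?thesis unfolding det_eq_0_iff_kernel by blast
qed

text \<open>The nonparallel pair rules out a common point of the normals at infinity.\<close>

lemma det_normal_matrix_eq_0_imp:
  assumes "det (normal_matrix P T) = 0" and "cross2 (T i) (T j) \<noteq> 0"
  obtains c where "\<And>i. (c - P i) \<bullet> T i = 0"
proof -
  obtain x where x: "x \<noteq> 0" "normal_matrix P T *v x = 0"
    using assms(1) unfolding det_eq_0_iff_kernel by blast
  define y :: "real^2" where "y = vector [x$1, x$2]"
  have eq: "y \<bullet> T i = x$3 * (P i \<bullet> T i)" for i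
    using arg_cong[OF x(2), of "\<lambda>v. v $ i"]
    by (simp add: normal_matrix_mult y_def inner_real2)
  have "x$3 \<noteq> 0"
  proof
    assume 0: "x$3 = 0"
    with x(1) have "y \<noteq> 0" by (auto simp: y_def vec_eq_iff forall_2 forall_3)
    with 0 eq have "cross2 (T i) (T j) = 0"
      by (intro cross2_eq_0_imp_orthogonal_to_common[of y]) auto
    with assms(2) show False by contradiction
  qed
  then have "((1 / x$3) *\<^sub>R y - P i) \<bullet> T i = 0" for i
    by (simp add: inner_diff_left eq)
  then show ?thesis using that by blast
qed

section \<open>The Coulomb determinant and the equivalence\<close>

lemma det_coulomb_matrix:
  assumes "inj P"
  shows "(dist (P 1) (P 2) * dist (P 2) (P 3) * dist (P 3) (P 1)) ^ 3 * det (coulomb_matrix P T)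
    = cross2 (P 1 - P 2) (P 3 - P 2) * det (normal_matrix P T)"
proof -
  define d where "d i j = dist (P i) (P j) ^ 3" for i j
  have sym: "d 2 1 = d 1 2" "d 3 2 = d 2 3" "d 1 3 = d 3 1"
    by (simp_all add: d_def dist_commute)
  have nz: "d 1 2 \<noteq> 0" "d 2 3 \<noteq> 0" "d 3 1 \<noteq> 0"
    using assms by (simp_all add: d_def inj_eq)
  \<comment> \<open>The zero diagonal leaves only the two 3-cycles in the expansion, and by symmetry
    of the distance both have the same denominator.\<close>
  have "det (coulomb_matrix P T) =
    (((P 1 - P 2) \<bullet> T 1) * ((P 2 - P 3) \<bullet> T 2) * ((P 3 - P 1) \<bullet> T 3)
     + ((P 1 - P 3) \<bullet> T 1) * ((P 2 - P 1) \<bullet> T 2) * ((P 3 - P 2) \<bullet> T 3)) / (d 1 2 * d 2 3 * d 3 1)"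
    unfolding det_3 coulomb_matrix_def d_def[symmetric]
    using nz by (simp add: sym add_divide_distrib mult_ac)
  then have "(d 1 2 * d 2 3 * d 3 1) * det (coulomb_matrix P T) =
    ((P 1 - P 2) \<bullet> T 1) * ((P 2 - P 3) \<bullet> T 2) * ((P 3 - P 1) \<bullet> T 3)
     + ((P 1 - P 3) \<bullet> T 1) * ((P 2 - P 1) \<bullet> T 2) * ((P 3 - P 2) \<bullet> T 3)"
    using nz by simp
  \<comment> \<open>A polynomial identity in the coordinates, valid for arbitrary \<open>P\<close>
    and \<open>T\<close>.\<close>
  also have "\<dots> = cross2 (P 1 - P 2) (P 3 - P 2) * det (normal_matrix P T)"
    unfolding det_3 normal_matrix_def cross2_def inner_real2
    by (simp add: algebra_simps)
  finally show ?thesis by (simp add: d_def power_mult_distrib)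
qed

text \<open>For collinear points the cross product factor vanishes, and for pairwise parallel
  tangents \<open>normal_matrix P T\<close> is singular. In both cases equilibrium charges exist
  although the normals need not meet, so the converse direction excludes them.\<close>

theorem theorem1:
  fixes X :: "(real^2) set" and P T :: "3 \<Rightarrow> real^2"
  assumes "smooth_closed_curve X"
    and "inj P" and "\<And>i. P i \<in> X"
    and "\<And>i. unit_tangent X (P i) (T i)"
  shows "(orthotripod X (range P) \<longrightarrow> (\<exists>q. in_equilibrium P T q)) \<and>
         (\<not> collinear (range P) \<and> (\<exists>i j. T i \<noteq> T j \<and> T i \<noteq> - T j) \<longrightarrow>
            ((\<exists>q. in_equilibrium P T q) \<longleftrightarrow> orthotripod X (range P)))"
proof -
  have equilibrium: "(\<exists>q. in_equilibrium P T q) \<longleftrightarrow>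
      cross2 (P 1 - P 2) (P 3 - P 2) * det (normal_matrix P T) = 0"
  proof -
    have "(\<exists>q. in_equilibrium P T q) \<longleftrightarrow> det (coulomb_matrix P T) = 0"
      unfolding in_equilibrium_def det_eq_0_iff_kernel ..
    then show ?thesis
      unfolding det_coulomb_matrix[OF assms(2), symmetric] using assms(2) by (simp add: inj_eq)
  qed
  have "card (range P) = 3" using card_image[OF assms(2)] by simp
  then have orthotripod: "orthotripod X (range P) \<longleftrightarrow> (\<exists>c. \<forall>i. (c - P i) \<bullet> T i = 0)"
    using assms(3) by (simp add: orthotripod_def normal_line_eq[OF assms(4)] image_subset_iff) blast
  have only_if: "\<exists>q. in_equilibrium P T q" if "orthotripod X (range P)"
    using that det_normal_matrix_eq_0 unfolding equilibrium orthotripod by fastforce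
  have "orthotripod X (range P)"
    if nc: "\<not> collinear (range P)" and T: "T i \<noteq> T j" "T i \<noteq> - T j"
      and "\<exists>q. in_equilibrium P T q" for i j
  proof -
    have "range P = {P 1, P 2, P 3}" by (simp add: UNIV_3)
    with nc that(4) have "det (normal_matrix P T) = 0"
      unfolding equilibrium using not_collinear_imp_cross2 by auto
    moreover have "cross2 (T i) (T j) \<noteq> 0"
    proof
      \<comment> \<open>Unit vectors equal their own \<open>sgn\<close>, so parallel ones would
        agree up to sign, against the choice of \<open>i\<close> and \<open>j\<close>.\<close>
      have unit: "norm (T k) = 1" "T k \<noteq> 0" "sgn (T k) = T k" for k
        using norm_unit_tangent[OF assms(4), of k] by (auto simp: sgn_div_norm)
      assume "cross2 (T i) (T j) = 0"
      then show False using cross2_eq_0_imp_sgn[of "T i" "T j"] T by (auto simp: unit)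
    qed
    ultimately show ?thesis
      unfolding orthotripod by (meson det_normal_matrix_eq_0_imp)
  qed
  with only_if show ?thesis by blast
qed

end
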